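(* Let $M\ge 1$ and $1\le K\le M$ be integers and let $0<p<1$. Let $\beta^*=1+\frac{2}{(K+1)(1-2^{-K})}$ and $q_0=(1-p)^M$. Then the expected number of users resolved per slot, $\overline{R}_{\mathrm{res}}$, of the generalized tree-splitting protocol with parameter $K$ satisfies $$\overline{R}_{\mathrm{res}}\ \ge\ 1-\frac{\beta^*-1}{\beta^*(1-q_0)}\,I_p(K+1,M-K).$$
   Context: Generalized tree-splitting protocol with parameter $K\ge1$. Let $T(L)$ be the random number of slots used to resolve a group of $L\ge 0$ users. If $L=0$, exactly one (empty) slot is used. If $1\le L\le K$, exactly $L$ slots are used. If $L>K$, one slot is used (a collision), after which each of the $L$ users independently joins group 1 or group 2 with probability $1/2$ each; then group 1 is resolved by a fresh run of the same protocol (with independent randomness), and afterwards group 2 is resolved by a fresh run of the same protocol (this also applies to empty groups). $T(L)$ is the total number of slots, and $S(L)=\mathbb{E}[T(L)]$. User activity: there are $M$ users, each independently active with probability $p$, so the number $L$ of active users is binomial, $q(L)=\binom{M}{L}p^L(1-p)^{M-L}$, $q_0=q(0)=(1-p)^M$, and $\hat q(L)=q(L)/(1-q_0)$ for $L\ge1$ is the distribution conditioned on $L\geq 1$. Define $$\overline{R}_{\mathrm{res}}=\sum_{L=1}^M\frac{L}{S(L)}\,\hat q(L).$$ $I_x(a,b)=B_x(a,b)/B_1(a,b)$, with $B_x(a,b)=\int_0^x t^{a-1}(1-t)^{b-1}\,dt$, is the regularized incomplete beta function, with the convention $I_p(M+1,0)=0$. *)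

theory Defs
  imports "HOL-Probability.Probability"
begin

text \<open>
  Number of users joining the first group when each of \<open>L\<close> users chooses between the two groups
  by an independent fair coin.
\<close>

definition first_group :: "nat \<Rightarrow> nat pmf" where
  "first_group L =
     map_pmf (\<lambda>c. card {u. u < L \<and> c u}) (Pi_pmf {..<L} False (\<lambda>_. bernoulli_pmf (1/2)))"

text \<open>
  The law of \<open>T(L)\<close>. The protocol has non-terminating runs (e.g. all users always join the same
  group), so the law is the least fixed point of the protocol's recursion in the type of
  subprobability distributions; the outcome \<^const>\<open>None\<close> carries the probability of
  non-termination.
\<close>

partial_function (spmf) slots :: "nat \<Rightarrow> nat \<Rightarrow> nat spmf" where
  "slots K L =
     (if L = 0 then return_spmf 1
      else if L \<le> K then return_spmf L
      else bind_spmf (spmf_of_pmf (first_group L)) (\<lambda>i.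
           bind_spmf (slots K i) (\<lambda>a.
           bind_spmf (slots K (L - i)) (\<lambda>b.
           return_spmf (1 + a + b)))))"

text \<open>
  Expectation of \<open>T(L)\<close> as a \<open>[0, \<infinity>]\<close>-valued random variable: a run that does not terminate uses
  infinitely many slots.
\<close>

definition expected_slots :: "nat \<Rightarrow> nat \<Rightarrow> ennreal" where
  "expected_slots K L =
     (\<integral>\<^sup>+ t. (case t of None \<Rightarrow> \<infinity> | Some n \<Rightarrow> of_nat n) \<partial>measure_pmf (slots K L))"

definition active_prob :: "nat \<Rightarrow> real \<Rightarrow> nat \<Rightarrow> real" where
  "active_prob M p L = pmf (binomial_pmf M p) L"

definition cond_active_prob :: "nat \<Rightarrow> real \<Rightarrow> nat \<Rightarrow> real" where
  "cond_active_prob M p L = active_prob M p L / (1 - active_prob M p 0)"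

text \<open>
  If \<open>S(L)\<close> were infinite, \<^const>\<open>enn2real\<close> would make the quotient \<open>L / S(L)\<close> equal to
  \<open>L / 0 = 0\<close>, which is also its value as a quotient by \<open>\<infinity>\<close>.
\<close>

definition resolution_rate :: "nat \<Rightarrow> nat \<Rightarrow> real \<Rightarrow> real" where
  "resolution_rate K M p =
     (\<Sum>L = 1..M. real L / enn2real (expected_slots K L) * cond_active_prob M p L)"

definition incomplete_beta :: "real \<Rightarrow> real \<Rightarrow> real \<Rightarrow> real" where
  "incomplete_beta x a b = integral {0..x} (\<lambda>t. t powr (a - 1) * (1 - t) powr (b - 1))"

text \<open>For \<open>b = 0\<close> the complete integral diverges; the value is \<open>0\<close> by convention.\<close>

definition regularized_incomplete_beta :: "real \<Rightarrow> real \<Rightarrow> real \<Rightarrow> real" where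
  "regularized_incomplete_beta x a b =
     (if b = 0 then 0 else incomplete_beta x a b / incomplete_beta 1 a b)"

definition beta_star :: "nat \<Rightarrow> real" where
  "beta_star K = 1 + 2 / ((real K + 1) * (1 - 1 / 2 ^ K))"

end

theory Submission
  imports Defs
begin

text \<open>
  For \<open>L > K\<close> we have \<open>S(L) \<le> \<beta> L - 1\<close>, where \<open>\<beta>\<close> is chosen so that equality holds at
  \<open>L = K + 1\<close>. The linear function \<open>\<beta> L - 1\<close> solves the recursion \<open>S(L) = 1 + 2 E S(i)\<close> exactly, so its
  defect against \<open>S\<close> is governed by the sums \<open>\<Sum>i\<le>K. (L choose i) V(i)\<close> of the defects
  \<open>V(i)\<close> at \<open>i \<le> K\<close>. This sum vanishes at \<open>L = K + 1\<close>, and stays nonnegative afterwards because \<open>V\<close>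
  changes sign only once, from negative to positive. The ratio \<open>L / S(L)\<close> is then \<open>1\<close> for
  \<open>1 \<le> L \<le> K\<close> and at least \<open>1 / \<beta>\<close> for \<open>L > K\<close>, and the binomial tail is an incomplete beta function.
\<close>

subsection \<open>The linear bound for the recursion\<close>

text \<open>This is the gap \<open>beta_star K * i - 1 - S(i)\<close> in the range
  \<open>i \<le> K\<close>, where \<open>S(i) = i\<close> except that an empty group costs one slot.
  The indicator accounts for \<open>S(0) = 1\<close>.\<close>

definition linear_defect :: "nat \<Rightarrow> nat \<Rightarrow> real" where
  "linear_defect K i = (beta_star K - 1) * real i - 1 - (if i = 0 then 1 else 0)"

lemma beta_star_gt_1:
  assumes "1 \<le> K"
  shows "beta_star K > 1"
proof -
  have "(1::real) < 2 ^ K" using assms by (intro one_less_power) auto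
  then show ?thesis by (simp add: beta_star_def)
qed

lemma choose_sum_lower:
  "(\<Sum>i\<le>K. real (Suc K choose i)) = 2 * 2 ^ K - 1"
proof -
  have "(\<Sum>i\<le>Suc K. real (Suc K choose i)) = 2 ^ Suc K"
    using choose_row_sum[of "Suc K"] by (simp flip: of_nat_sum)
  then show ?thesis by (simp only: sum.atMost_Suc) simp
qed

lemma choose_linear_sum_real:
  "(\<Sum>i\<le>n. real (n choose i) * real i) = real n * 2 ^ n / 2"
proof (cases n)
  case (Suc m)
  have "(\<Sum>i\<le>n. real (n choose i) * real i) = real (\<Sum>i\<le>n. i * (n choose i))"
    by (simp add: mult.commute)
  also have "\<dots> = real n * 2 ^ n / 2"
    unfolding choose_linear_sum by (simp add: Suc algebra_simps)
  finally show ?thesis .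
qed simp

text \<open>The sum is affine in \<open>beta_star K\<close>, with slope
  \<open>(K + 1) * (2 ^ K - 1)\<close>, and its vanishing is the equation that determines
  \<open>beta_star K\<close>.\<close>

lemma choose_linear_defect_base:
  assumes "1 \<le> K"
  shows "(\<Sum>i\<le>K. real (Suc K choose i) * linear_defect K i) = 0"
proof -
  define b where "b = beta_star K - 1"
  have gt: "(1::real) < 2 ^ K" using assms by (intro one_less_power) auto
  have b: "b * ((real K + 1) * (2 ^ K - 1)) = 2 * 2 ^ K"
    using gt unfolding b_def beta_star_def by (simp add: divide_simps)
  have lin: "(\<Sum>i\<le>K. real (Suc K choose i) * real i) = (real K + 1) * (2 ^ K - 1)"
    using choose_linear_sum_real[of "Suc K"] by (simp only: sum.atMost_Suc) (simp add: algebra_simps)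
  have "(\<Sum>i\<le>K. real (Suc K choose i) * linear_defect K i) =
      b * (\<Sum>i\<le>K. real (Suc K choose i) * real i) - (\<Sum>i\<le>K. real (Suc K choose i))
      - (\<Sum>i\<le>K. real (Suc K choose i) * (if i = 0 then 1 else 0))"
    unfolding sum_distrib_left sum_subtractf[symmetric] linear_defect_def b_def
    by (intro sum.cong refl) (simp add: algebra_simps)
  also have "(\<Sum>i\<le>K. real (Suc K choose i) * (if i = 0 then 1 else 0)) = 1"
    by (simp add: if_distrib[of "\<lambda>x. _ * x"] sum.delta cong: if_cong)
  finally show ?thesis unfolding lin choose_sum_lower b by simp
qed

text \<open>Passing from \<open>n\<close> to \<open>n + 1\<close> multiplies the weight at
  \<open>i\<close> by \<open>(n + 1) / (n + 1 - i)\<close>, which grows with \<open>i\<close>. The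
  defects after the sign change thus gain relative to those before it. Comparing each factor with
  its value at the crossing point \<open>c\<close> gives the induction step.\<close>

lemma choose_linear_defect_nonneg:
  assumes "1 \<le> K" "Suc K \<le> n"
  shows "0 \<le> (\<Sum>i\<le>K. real (n choose i) * linear_defect K i)"
  using assms(2)
proof (induction n rule: dec_induct)
  case base
  show ?case using choose_linear_defect_base[OF assms(1)] by simp
next
  case (step n)
  define b where "b = beta_star K - 1"
  \<comment> \<open>the point where the linear part of the defect changes sign\<close>
  define c where "c = 1 / b"
  have b: "b > 0" using beta_star_gt_1[OF assms(1)] by (simp add: b_def)
  \<comment> \<open>The crossing point is at most \<open>(K + 1) / 2\<close>, so the factor
    \<open>n + 1 - c\<close> is positive and can be cancelled at the end.\<close>
  have "c = (real K + 1) * (1 - 1 / 2 ^ K) / 2"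
    unfolding c_def b_def beta_star_def by simp
  also have "\<dots> \<le> (real K + 1) * 1 / 2"
    by (intro divide_right_mono mult_left_mono) auto
  also have "\<dots> < real n + 1" using step.hyps by simp
  finally have c: "c < real n + 1" .
  have "0 \<le> (real n + 1) * (\<Sum>i\<le>K. real (n choose i) * linear_defect K i)"
    using step.IH by simp
  also have "\<dots> \<le> (real n + 1 - c) * (\<Sum>i\<le>K. real (Suc n choose i) * linear_defect K i)"
    unfolding sum_distrib_left
  proof (rule sum_mono)
    fix i assume "i \<in> {..K}"
    then have i: "i \<le> n" using step.hyps by simp
    have "Suc n * (n choose i) = (Suc n - i) * (Suc n choose i)"
      using binomial_absorb_comp[of "Suc n" i] by simp
    then have "real (Suc n) * real (n choose i) = real (Suc n - i) * real (Suc n choose i)"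
      by (metis of_nat_mult)
    then have absorb: "(real n + 1) * real (n choose i) = (real n + 1 - real i) * real (Suc n choose i)"
      using i by (simp add: of_nat_diff add.commute)
    have "0 \<le> linear_defect K i * (real i - c)"
    proof (cases "i = 0")
      case True
      then show ?thesis using b by (simp add: linear_defect_def c_def)
    next
      case False
      have "b * c = 1" using b by (simp add: c_def)
      then have "linear_defect K i = b * (real i - c)"
        using False by (simp add: linear_defect_def b_def right_diff_distrib)
      then have "linear_defect K i * (real i - c) = b * (real i - c) ^ 2"
        by (simp add: power2_eq_square)
      then show ?thesis using b by simp
    qed
    then have "0 \<le> real (Suc n choose i) * (linear_defect K i * (real i - c))"
      by (rule mult_nonneg_nonneg[OF of_nat_0_le_iff])
    moreover have "(real n + 1) * (real (n choose i) * linear_defect K i)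
        = (real n + 1 - real i) * (real (Suc n choose i) * linear_defect K i)"
      unfolding mult.assoc[symmetric] absorb ..
    ultimately show "(real n + 1) * (real (n choose i) * linear_defect K i)
        \<le> (real n + 1 - c) * (real (Suc n choose i) * linear_defect K i)"
      by (simp add: algebra_simps del: binomial_Suc_Suc)
  qed
  finally show ?case using c by (simp add: zero_le_mult_iff)
qed

text \<open>Only inequalities on a real-valued \<open>e\<close> are assumed, so that truncated
  expectations qualify. Finiteness matters because the recursion for \<open>e L\<close> contains
  \<open>e L\<close> itself, at \<open>i = 0\<close> and \<open>i = L\<close>.\<close>

lemma splitting_recursion_bound:
  fixes e :: "nat \<Rightarrow> real"
  assumes K: "1 \<le> K"
    and e0: "e 0 \<le> 1"
    and eK: "\<And>i. 1 \<le> i \<Longrightarrow> i \<le> K \<Longrightarrow> e i \<le> real i"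
    and rec: "\<And>L. K < L \<Longrightarrow> e L \<le> 1 + (\<Sum>i\<le>L. real (L choose i) / 2 ^ L * (e i + e (L - i)))"
    and L: "K < L"
  shows "e L \<le> beta_star K * real L - 1"
  using L
proof (induction L rule: less_induct)
  case (less L)
  define b where "b = beta_star K"
  define g where "g i = b * real i - 1 - e i" for i
  have g: "g i \<ge> linear_defect K i" if "i \<le> K" for i
    using e0 eK[of i] that by (cases "i = 0") (auto simp: g_def linear_defect_def b_def algebra_simps)
  have g': "g i \<ge> 0" if "K < i" "i < L" for i
    using less.IH[OF that(2,1)] by (simp add: g_def b_def)
  have "(\<Sum>i\<le>L. real (L choose i) * e (L - i)) = (\<Sum>i\<le>L. real (L choose i) * e i)"
    by (rule sum.reindex_bij_witness[of _ "\<lambda>i. L - i" "\<lambda>i. L - i"])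
      (auto simp: binomial_symmetric[symmetric])
  then have "(\<Sum>i\<le>L. real (L choose i) / 2 ^ L * (e i + e (L - i)))
      = 2 / 2 ^ L * (\<Sum>i\<le>L. real (L choose i) * e i)"
    by (simp add: distrib_left sum.distrib flip: sum_divide_distrib)
  with rec[OF less.prems] have rec': "e L \<le> 1 + 2 / 2 ^ L * (\<Sum>i\<le>L. real (L choose i) * e i)"
    by simp
  have "(\<Sum>i\<le>L. real (L choose i) * g i) = b * (\<Sum>i\<le>L. real (L choose i) * real i)
      - (\<Sum>i\<le>L. real (L choose i)) - (\<Sum>i\<le>L. real (L choose i) * e i)"
    unfolding sum_distrib_left sum_subtractf[symmetric] g_def
    by (intro sum.cong refl) (simp add: algebra_simps)
  also have "(\<Sum>i\<le>L. real (L choose i)) = 2 ^ L"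
    using choose_row_sum[of L] by (simp flip: of_nat_sum)
  finally have G: "(\<Sum>i\<le>L. real (L choose i) * g i) =
      b * (real L * 2 ^ L / 2) - 2 ^ L - (\<Sum>i\<le>L. real (L choose i) * e i)"
    unfolding choose_linear_sum_real .
  have "2 / 2 ^ L * (\<Sum>i\<le>L. real (L choose i) * g i) =
      b * real L - 2 - 2 / 2 ^ L * (\<Sum>i\<le>L. real (L choose i) * e i)"
    unfolding G by (simp add: field_simps)
  \<comment> \<open>Since \<open>b * i - 1\<close> solves the recursion exactly, the constant 1
    cancels and \<open>g\<close> satisfies a homogeneous inequality.\<close>
  with rec' have 1: "2 / 2 ^ L * (\<Sum>i\<le>L. real (L choose i) * g i) \<le> g L"
    by (simp add: g_def)
  have "0 \<le> (\<Sum>i\<le>K. real (L choose i) * linear_defect K i)"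
    using choose_linear_defect_nonneg[OF K] less.prems by simp
  also have "\<dots> \<le> (\<Sum>i\<le>K. real (L choose i) * g i)"
    by (intro sum_mono mult_left_mono) (use g in auto)
  also have "\<dots> \<le> (\<Sum>i<L. real (L choose i) * g i)"
    by (rule sum_mono2) (use g' less.prems in auto)
  finally have "g L \<le> (\<Sum>i\<le>L. real (L choose i) * g i)"
    by (simp add: lessThan_Suc_atMost[symmetric])
  \<comment> \<open>What is left on the right is the multiple of \<open>g L\<close> from the case
    that all users choose the same group. It is absorbed on the left, since \<open>L \<ge> 2\<close>
    makes its coefficient less than 1.\<close>
  then have "2 / 2 ^ L * g L \<le> g L"
    using 1 by (meson divide_nonneg_pos mult_left_mono order_trans zero_le_numeral zero_less_numeral zero_less_power)
  moreover have "(2::real) ^ 1 < 2 ^ L"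
    using less.prems K by (intro power_strict_increasing) auto
  ultimately have "0 \<le> (1 - 2 / 2 ^ L) * g L" "(2::real) / 2 ^ L < 1"
    by (simp_all add: left_diff_distrib)
  then have "0 \<le> g L" by (simp add: zero_le_mult_iff)
  then show ?case by (simp add: g_def b_def)
qed

subsection \<open>The expected number of slots\<close>

abbreviation slot_count :: "nat option \<Rightarrow> ennreal" where
  "slot_count t \<equiv> (case t of None \<Rightarrow> \<infinity> | Some n \<Rightarrow> of_nat n)"

lemma pmf_first_group: "pmf (first_group L) i = real (L choose i) / 2 ^ L"
proof -
  have "first_group L = binomial_pmf L (1/2)"
    unfolding first_group_def
    by (subst binomial_pmf_altdef'[of "{..<L}" L "1/2" False]) auto
  then show ?thesis
    by (cases "i \<le> L") (auto simp: binomial_eq_0 power_divide simp flip: power_add)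
qed

lemma nn_integral_first_group:
  "(\<integral>\<^sup>+ i. f i \<partial>measure_pmf (first_group L)) = (\<Sum>i\<le>L. ennreal (real (L choose i) / 2 ^ L) * f i)"
proof -
  have "set_pmf (first_group L) \<subseteq> {..L}"
    by (auto simp: set_pmf_eq pmf_first_group)
  then show ?thesis
    by (subst nn_integral_measure_pmf_support[of "{..L}"])
      (auto simp: pmf_first_group mult.commute intro!: sum.cong)
qed

lemma sum_first_group: "(\<Sum>i\<le>L. ennreal (real (L choose i) / 2 ^ L)) = 1"
  using nn_integral_first_group[where f = "\<lambda>_. 1" and L = L] by simp

text \<open>Non-termination of either subgroup is non-termination of the whole run.\<close>

definition join_runs :: "nat option \<Rightarrow> nat option \<Rightarrow> nat option" where
  "join_runs a b = Option.bind a (\<lambda>m. map_option (\<lambda>n. 1 + m + n) b)"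

lemma slot_count_join_runs: "slot_count (join_runs a b) = 1 + slot_count a + slot_count b"
  by (auto simp: join_runs_def split: option.splits)

text \<open>A general \<open>f\<close> is kept because the identity serves both the full slot count
  and its truncations.\<close>

lemma nn_integral_slots_split:
  assumes "K < L"
  shows "(\<integral>\<^sup>+ t. f t \<partial>measure_pmf (slots K L)) =
    (\<Sum>i\<le>L. ennreal (real (L choose i) / 2 ^ L) *
       (\<integral>\<^sup>+ a. \<integral>\<^sup>+ b. f (join_runs a b) \<partial>measure_pmf (slots K (L - i)) \<partial>measure_pmf (slots K i)))"
proof -
  have "slots K L = bind_pmf (first_group L) (\<lambda>i. bind_pmf (slots K i) (\<lambda>a.
      bind_pmf (slots K (L - i)) (\<lambda>b. return_pmf (join_runs a b))))"
    using assms
    by (subst slots.simps)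
      (auto simp: bind_spmf_def spmf_of_pmf_def bind_map_pmf join_runs_def
        intro!: bind_pmf_cong split: option.splits)
  then show ?thesis
    by (simp add: nn_integral_bind_pmf nn_integral_first_group)
qed

lemma expected_slots_0: "expected_slots K 0 = 1"
  unfolding expected_slots_def by (subst slots.simps) simp

lemma expected_slots_le_K:
  assumes "1 \<le> L" "L \<le> K"
  shows "expected_slots K L = of_nat L"
  unfolding expected_slots_def using assms by (subst slots.simps) simp

lemma expected_slots_split:
  assumes "K < L"
  shows "expected_slots K L = 1 + (\<Sum>i\<le>L. ennreal (real (L choose i) / 2 ^ L) *
    (expected_slots K i + expected_slots K (L - i)))"
  unfolding expected_slots_def nn_integral_slots_split[OF assms] slot_count_join_runs
  by (simp add: nn_integral_add add.assoc distrib_left sum.distrib sum_first_group)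

text \<open>
  The recursion for the expectation alone does not exclude the value \<open>\<infinity>\<close>; the truncated expectations
  are finite and satisfy it as an inequality.
\<close>

lemma truncated_slots_bound:
  assumes K: "1 \<le> K" and L: "K < L"
  shows "(\<integral>\<^sup>+ t. min (slot_count t) (of_nat N) \<partial>measure_pmf (slots K L))
    \<le> ennreal (beta_star K * real L - 1)"
proof -
  define E where "E i = (\<integral>\<^sup>+ t. min (slot_count t) (of_nat N) \<partial>measure_pmf (slots K i))" for i
  have fin: "E i < \<top>" for i
  proof -
    have "E i \<le> (\<integral>\<^sup>+ t. of_nat N \<partial>measure_pmf (slots K i))"
      unfolding E_def by (intro nn_integral_mono) auto
    then show ?thesis by (simp add: order_le_less_trans[OF _ of_nat_less_top])
  qed
  have le: "E i \<le> expected_slots K i" for i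
    unfolding E_def expected_slots_def by (intro nn_integral_mono) auto
  \<comment> \<open>If either argument exceeds \<open>N\<close>, the right side is already at least
    \<open>N\<close>; otherwise no truncation takes place on the right.\<close>
  have trunc: "min (1 + x + y) (of_nat N) \<le> 1 + (min x (of_nat N) + min y (of_nat N))" for x y :: ennreal
  proof (cases "x \<le> of_nat N \<and> y \<le> of_nat N")
    case True
    then show ?thesis by (simp add: min.absorb1 add.assoc)
  next
    case False
    then have "of_nat N \<le> min x (of_nat N) + min y (of_nat N)"
      by (auto simp: min_def intro: add_increasing add_increasing2)
    then show ?thesis by (intro min.coboundedI2) (simp add: add_increasing)
  qed
  have rec: "E j \<le> 1 + (\<Sum>i\<le>j. ennreal (real (j choose i) / 2 ^ j) * (E i + E (j - i)))" if "K < j" for j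
  proof -
    have "E j \<le> (\<Sum>i\<le>j. ennreal (real (j choose i) / 2 ^ j) *
        (\<integral>\<^sup>+ a. \<integral>\<^sup>+ b. 1 + (min (slot_count a) (of_nat N) + min (slot_count b) (of_nat N))
          \<partial>measure_pmf (slots K (j - i)) \<partial>measure_pmf (slots K i)))"
      unfolding E_def nn_integral_slots_split[OF that] slot_count_join_runs
      by (intro sum_mono mult_left_mono nn_integral_mono trunc) auto
    also have "\<dots> = 1 + (\<Sum>i\<le>j. ennreal (real (j choose i) / 2 ^ j) * (E i + E (j - i)))"
      unfolding E_def by (simp add: nn_integral_add distrib_left sum.distrib sum_first_group)
    finally show ?thesis .
  qed
  have real: "E i = ennreal (enn2real (E i))" for i
    using fin[of i] by simp
  have "enn2real (E L) \<le> beta_star K * real L - 1"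
  proof (rule splitting_recursion_bound[OF K _ _ _ L])
    show "enn2real (E 0) \<le> 1"
      using le[of 0] by (intro enn2real_leI) (auto simp: expected_slots_0)
    show "enn2real (E i) \<le> real i" if "1 \<le> i" "i \<le> K" for i
      using le[of i] that by (intro enn2real_leI) (auto simp: expected_slots_le_K ennreal_of_nat_eq_real_of_nat)
    show "enn2real (E j) \<le> 1 + (\<Sum>i\<le>j. real (j choose i) / 2 ^ j * (enn2real (E i) + enn2real (E (j - i))))"
      if "K < j" for j
    proof (rule enn2real_leI)
      have "1 + (\<Sum>i\<le>j. ennreal (real (j choose i) / 2 ^ j) * (E i + E (j - i))) =
          1 + (\<Sum>i\<le>j. ennreal (real (j choose i) / 2 ^ j) *
            (ennreal (enn2real (E i)) + ennreal (enn2real (E (j - i)))))"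
        using real by simp
      also have "\<dots> = ennreal (1 + (\<Sum>i\<le>j. real (j choose i) / 2 ^ j * (enn2real (E i) + enn2real (E (j - i)))))"
        by (simp add: ennreal_plus[symmetric] ennreal_mult[symmetric] sum_ennreal sum_nonneg
            ennreal_1[symmetric] del: ennreal_plus ennreal_1)
      finally show "E j \<le> ennreal (1 + (\<Sum>i\<le>j. real (j choose i) / 2 ^ j * (enn2real (E i) + enn2real (E (j - i)))))"
        using rec[OF that] by simp
    qed (auto intro!: add_nonneg_nonneg sum_nonneg)
  qed
  then show ?thesis using real[of L] ennreal_leI unfolding E_def by metis
qed

text \<open>The truncated bound is uniform in \<open>N\<close>, so monotone convergence transfers it
  to the full expectation. In particular, non-termination has probability zero.\<close>

lemma expected_slots_bound:
  assumes "1 \<le> K" "K < L"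
  shows "expected_slots K L \<le> ennreal (beta_star K * real L - 1)"
proof -
  have sup: "slot_count t = (SUP N. min (slot_count t) (of_nat N))" for t
  proof (rule antisym)
    show "slot_count t \<le> (SUP N. min (slot_count t) (of_nat N))"
    proof (cases t)
      case None
      then show ?thesis by (simp add: ennreal_SUP_of_nat_eq_top min_def top_unique)
    next
      case (Some n)
      then show ?thesis by (intro SUP_upper2[of n]) auto
    qed
  qed (auto intro: SUP_least)
  have "expected_slots K L = (\<integral>\<^sup>+ t. (SUP N. min (slot_count t) (of_nat N)) \<partial>measure_pmf (slots K L))"
    unfolding expected_slots_def sup[symmetric] ..
  also have "\<dots> = (SUP N. \<integral>\<^sup>+ t. min (slot_count t) (of_nat N) \<partial>measure_pmf (slots K L))"
    by (intro nn_integral_monotone_convergence_SUP) (auto simp: incseq_def le_fun_def intro: min.coboundedI2)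
  also have "\<dots> \<le> ennreal (beta_star K * real L - 1)"
    by (intro SUP_least truncated_slots_bound assms)
  finally show ?thesis .
qed

lemma slot_ratio_bound:
  assumes "1 \<le> K" "K < L"
  shows "1 / beta_star K \<le> real L / enn2real (expected_slots K L)"
proof -
  define s where "s = enn2real (expected_slots K L)"
  have b: "beta_star K > 1" by (rule beta_star_gt_1[OF assms(1)])
  have le: "expected_slots K L \<le> ennreal (beta_star K * real L - 1)"
    by (rule expected_slots_bound[OF assms])
  \<comment> \<open>The collision slot keeps the denominator away from zero; the upper bound
    \<open>le\<close> ensures that \<open>enn2real\<close> does not collapse an infinite value to
    0.\<close>
  have "1 \<le> expected_slots K L"
    unfolding expected_slots_split[OF assms(2)] by simp
  then have s1: "1 \<le> s"
    using le unfolding s_def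
    by (metis enn2real_mono enn2real_1 ennreal_less_top order_le_less_trans)
  have "1 * 1 \<le> beta_star K * real L" using b assms by (intro mult_mono) auto
  then have "s \<le> beta_star K * real L - 1"
    unfolding s_def using le by (intro enn2real_leI) auto
  then show ?thesis using s1 b unfolding s_def[symmetric] by (simp add: field_simps)
qed

subsection \<open>The binomial tail as an incomplete beta function\<close>

text \<open>The derivative telescopes: differentiating the power of \<open>x\<close> in each new
  term cancels the derivative of the preceding partial sum.\<close>

lemma binomial_head_has_derivative:
  assumes "K < M"
  shows "((\<lambda>x::real. \<Sum>L\<le>K. real (M choose L) * x ^ L * (1 - x) ^ (M - L)) has_real_derivative
    - (real (M - K) * real (M choose K) * x ^ K * (1 - x) ^ (M - K - 1))) (at x)"
  using assms
proof (induction K)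
  case 0
  show ?case by (auto intro!: derivative_eq_intros)
next
  case (Suc K)
  have "(M - K) * (M choose K) = Suc K * (M choose Suc K)"
    using Suc.prems by (metis binomial_absorb_comp binomial_absorption)
  then have absorb: "real (M - K) * real (M choose K) = real (Suc K) * real (M choose Suc K)"
    by (metis of_nat_mult)
  have "((\<lambda>x::real. real (M choose Suc K) * x ^ Suc K * (1 - x) ^ (M - Suc K)) has_real_derivative
      real (M - K) * real (M choose K) * x ^ K * (1 - x) ^ (M - K - 1)
      - real (M - Suc K) * real (M choose Suc K) * x ^ Suc K * (1 - x) ^ (M - Suc K - 1)) (at x)"
    unfolding absorb by (rule derivative_eq_intros refl)+ (simp add: algebra_simps)
  from DERIV_add[OF Suc.IH this] Suc.prems show ?case by simp
qed

lemma incomplete_beta_binomial_tail: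
  assumes "1 \<le> K" "K < M" "0 \<le> x" "x \<le> 1"
  shows "real (M - K) * real (M choose K) * incomplete_beta x (real K + 1) (real M - real K)
    = 1 - (\<Sum>L\<le>K. real (M choose L) * x ^ L * (1 - x) ^ (M - L))"
proof -
  define c where "c = real (M - K) * real (M choose K)"
  have c: "c > 0" using assms by (simp add: c_def)
  define F where "F x = - (\<Sum>L\<le>K. real (M choose L) * x ^ L * (1 - x) ^ (M - L)) / c" for x :: real
  have "((\<lambda>t. t ^ K * (1 - t) ^ (M - K - 1)) has_integral F x - F 0) {0..x}"
  proof (rule fundamental_theorem_of_calculus)
    fix t :: real
    have "(F has_real_derivative t ^ K * (1 - t) ^ (M - K - 1)) (at t)"
      using DERIV_cdivide[OF DERIV_minus[OF binomial_head_has_derivative[OF assms(2)]], of c t] c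
      unfolding F_def c_def[symmetric] by simp
    then show "(F has_vector_derivative t ^ K * (1 - t) ^ (M - K - 1)) (at t within {0..x})"
      by (simp add: has_real_derivative_iff_has_vector_derivative has_vector_derivative_at_within)
  qed (use assms in simp)
  \<comment> \<open>The two integrands can differ at an endpoint: for \<open>M = K + 1\<close> and
    \<open>t = 1\<close>, \<open>0 powr 0\<close> is 0 whereas \<open>0 ^ 0\<close> is 1.\<close>
  then have "((\<lambda>t. t powr (real K + 1 - 1) * (1 - t) powr (real M - real K - 1))
      has_integral F x - F 0) {0..x}"
  proof (rule has_integral_spike_finite[rotated 2])
    show "finite {0, 1::real}" by simp
    fix t assume "t \<in> {0..x} - {0, 1}"
    then have "0 < t" "t < 1" using assms by auto
    moreover have diff: "real M - real K - 1 = real (M - K - 1)" using assms by (simp add: of_nat_diff)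
    ultimately show "t powr (real K + 1 - 1) * (1 - t) powr (real M - real K - 1)
        = t ^ K * (1 - t) ^ (M - K - 1)"
      unfolding diff by (simp only: add_diff_cancel_right' powr_realpow diff_gt_0_iff_gt)
  qed
  then have "incomplete_beta x (real K + 1) (real M - real K) = F x - F 0"
    unfolding incomplete_beta_def by (rule integral_unique)
  moreover have "(\<Sum>L\<le>K. real (M choose L) * 0 ^ L * (1 - 0) ^ (M - L)) = (1::real)"
    by (simp add: sum.atMost_shift)
  ultimately show ?thesis using c unfolding F_def c_def[symmetric] by (simp add: field_simps)
qed

lemma regularized_incomplete_beta_binomial_tail:
  assumes "1 \<le> K" "K \<le> M" "0 \<le> p" "p \<le> 1"
  shows "regularized_incomplete_beta p (real K + 1) (real M - real K)
    = (\<Sum>L=Suc K..M. active_prob M p L)"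
proof (cases "K = M")
  \<comment> \<open>Here the second beta parameter is 0, and the conventional value 0 matches the
    empty tail.\<close>
  case True
  then show ?thesis by (simp add: regularized_incomplete_beta_def)
next
  case False
  then have KM: "K < M" using assms by simp
  define c where "c = real (M - K) * real (M choose K)"
  have c: "c > 0" using KM by (simp add: c_def)
  \<comment> \<open>At \<open>x = 1\<close> every head term has a positive power of zero, so the
    tail identity identifies the complete beta integral as \<open>1 / c\<close>.\<close>
  have "(\<Sum>L\<le>K. real (M choose L) * 1 ^ L * (1 - 1) ^ (M - L)) = (0::real)"
    by (rule sum.neutral) (use KM in auto)
  then have 1: "c * incomplete_beta 1 (real K + 1) (real M - real K) = 1"
    using incomplete_beta_binomial_tail[of K M 1] assms KM by (simp add: c_def)
  have "incomplete_beta p (real K + 1) (real M - real K) / incomplete_beta 1 (real K + 1) (real M - real K)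
      = c * incomplete_beta p (real K + 1) (real M - real K)"
    using 1 by (metis divide_divide_eq_right div_by_1 mult.commute nonzero_eq_divide_eq mult_zero_right zero_neq_one)
  also have "\<dots> = 1 - (\<Sum>L\<le>K. active_prob M p L)"
    using incomplete_beta_binomial_tail[of K M p] assms KM
    by (simp add: c_def active_prob_def)
  also have "\<dots> = (\<Sum>L=Suc K..M. active_prob M p L)"
  proof -
    have "(\<Sum>L\<le>M. active_prob M p L) = 1"
      unfolding active_prob_def by (rule sum_pmf_eq_1) (use assms in \<open>auto simp: set_pmf_eq\<close>)
    moreover have "{..M} = {..K} \<union> {Suc K..M}" using KM by auto
    ultimately show ?thesis by (simp add: sum.union_disjoint ivl_disj_int)
  qed
  finally show ?thesis using KM by (simp add: regularized_incomplete_beta_def)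
qed

section \<open>Lower bound for the rate from the head and tail of the conditional activity
  distribution\<close>

theorem theorem5:
  fixes M K :: nat and p :: real
  assumes "M \<ge> 1" and "1 \<le> K" and "K \<le> M" and "0 < p" and "p < 1"
  shows "resolution_rate K M p \<ge>
           1 - (beta_star K - 1) / (beta_star K * (1 - (1 - p) ^ M))
                 * regularized_incomplete_beta p (real K + 1) (real M - real K)"
proof -
  define Q where "Q = 1 - (1 - p) ^ M"
  define b where "b = beta_star K"
  define q where "q = cond_active_prob M p"
  define I where "I = regularized_incomplete_beta p (real K + 1) (real M - real K)"
  have b: "b > 1" using beta_star_gt_1[OF assms(2)] by (simp add: b_def)
  have "(1 - p) ^ M < 1" using assms by (intro power_less_one_iff[THEN iffD2]) auto
  then have Q: "Q > 0" by (simp add: Q_def)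
  have a0: "active_prob M p 0 = (1 - p) ^ M" using assms by (simp add: active_prob_def)
  then have q: "q L = active_prob M p L / Q" for L by (simp add: q_def cond_active_prob_def Q_def)
  have q_nonneg: "q L \<ge> 0" for L using Q by (simp add: q active_prob_def)
  have split: "{1..M} = {1..K} \<union> {Suc K..M}" "{1..K} \<inter> {Suc K..M} = {}" using assms by auto
  have "(\<Sum>L\<le>M. active_prob M p L) = 1"
    unfolding active_prob_def by (rule sum_pmf_eq_1) (use assms in \<open>auto simp: set_pmf_eq\<close>)
  then have "(\<Sum>L=1..M. active_prob M p L) = Q"
    by (simp add: atMost_atLeast0 sum.atLeast_Suc_atMost a0 Q_def)
  then have total: "(\<Sum>L=1..M. q L) = 1" using Q by (simp add: q flip: sum_divide_distrib)
  have tail: "(\<Sum>L=Suc K..M. q L) = I / Q"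
    unfolding I_def using regularized_incomplete_beta_binomial_tail[of K M p] assms
    by (simp add: q flip: sum_divide_distrib)
  \<comment> \<open>The claimed bound is the head mass plus \<open>1 / b\<close> times the tail
    mass, which reduces the claim to a termwise comparison.\<close>
  have "1 - (b - 1) / (b * Q) * I = (1 - I / Q) + 1 / b * (I / Q)"
    using b Q by (simp add: field_simps)
  also have "\<dots> = (\<Sum>L=1..K. q L) + 1 / b * (\<Sum>L=Suc K..M. q L)"
    using total unfolding tail[symmetric] split(1)
    by (subst (asm) sum.union_disjoint) (use split(2) in auto)
  also have "\<dots> \<le> (\<Sum>L=1..K. real L / enn2real (expected_slots K L) * q L)
      + (\<Sum>L=Suc K..M. real L / enn2real (expected_slots K L) * q L)"
    unfolding sum_distrib_left
  proof (intro add_mono sum_mono)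
    fix L assume "L \<in> {1..K}"
    then show "q L \<le> real L / enn2real (expected_slots K L) * q L"
      by (simp add: expected_slots_le_K ennreal_of_nat_eq_real_of_nat)
  next
    fix L assume "L \<in> {Suc K..M}"
    then show "1 / b * q L \<le> real L / enn2real (expected_slots K L) * q L"
      unfolding b_def by (intro mult_right_mono slot_ratio_bound q_nonneg) (use assms in auto)
  qed
  also have "\<dots> = resolution_rate K M p"
    unfolding resolution_rate_def split(1) q_def
    by (rule sum.union_disjoint[symmetric]) (use split(2) in auto)
  finally show ?thesis by (simp add: b_def Q_def I_def)
qed

end
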